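(* Let $P$ be a principal with set $\mathsf{LAS}_P$ of local-axiom schema instances, and let $T$ be a finite set of non-negated atomic statements (says-statements and statements of the form $P\text{ trusts }\varphi$). The saturation algorithm run on $T$ (described in the context, with outputs $\mathit{Resulta}$ and $\mathit{Resultb}$) is sound (any statement in the saturation set $\mathit{Resultb}$ is derivable from $T$), complete (if a sattestation-free statement is derivable from $T$, it appears in $\mathit{Resultb}$), and terminating, with $\mathsf{labels}(\mathit{Resultb})\subseteq\mathsf{lc}(T)$ and $\mathsf{IDs}(\mathit{Resultb})\subseteq\mathsf{IDs}(T)$.
   Context: **Labels.** $\widehat\Lambda$ is a (possibly infinite) set of (sattestor-free) labels with a partial order $\prec$ ($\ell_1\prec\ell_2$: "$\ell_1$ narrows $\ell_2$", "$\ell_2$ broadens $\ell_1$"); $\preceq,\succ,\succeq$ are the derived relations. It contains a distinguished label $\mathsf{bound}$, incomparable to every other label. For every $\ell$ the set $\{\ell':\ell'\succeq\ell\}$ is finite and linearly ordered. $\widehat\Gamma=\widehat\Lambda\cup\{\mathsf{sattestor}(\ell):\ell\in\widehat\Lambda\}\cup\{\mathsf{sattestor}^*(\ell):\ell\in\widehat\Lambda\}$ (formal, distinct expressions). $\ell$'s range over $\widehat\Lambda$, $g$'s over $\widehat\Gamma$. **Language.** $D$ ranges over domain names, $O$ over onion addresses. A principal is an element of a set $\mathcal P$, or $\langle D,O\rangle$, or a pair $(D,O)$. A bound labeled pair is $\langle D,O\rangle$ (synonymous with $\langle D,O,\mathsf{bound}\rangle$) or $\langle D,O,g\rangle$. A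 says-statement is $(D,O)\text{ says }\pi$, $\pi$ a bound labeled pair. A trust statement is $P\text{ trusts }\chi$, $\chi$ a says-statement or bound labeled pair. Order statements are $\ell\preceq\ell'$ (also written $\ell'\succeq\ell$). Formulae are built from statements with $\rightarrow$ and $\land$. **Axioms** (all instances): - A1: $(\ell_1\succeq\ell_2 \land P\text{ trusts }\langle D,O,\ell_2\rangle)\rightarrow P\text{ trusts }\langle D,O,\ell_1\rangle$. - A2: $(\ell_1\succeq\ell_2\succeq\ell_3 \land P\text{ trusts }\langle D_1,O_1,\mathsf{sattestor}(\ell_1)\rangle \land P\text{ trusts }(D_1,O_1)\text{ says }\langle D_2,O_2,\ell_2\rangle \land P\text{ trusts }(D_2,O_2)\text{ says }\langle D_2,O_2,\ell_3\rangle)\rightarrow P\text{ trusts }\langle D_2,O_2,\ell_2\rangle$. - A3: $(\ell_1\succeq\ell_2\succeq\ell_3 \land P\text{ trusts }\langle D_1,O_1,\mathsf{sattestor}^*(\ell_1)\rangle \land P\text{ trusts }(D_1,O_1)\text{ says }\langle D_2,O_2,\mathsf{sattestor}^*(\ell_2)\rangle \land P\text{ trusts }(D_2,O_2)\text{ says }\langle D_3,O_3,\mathsf{sattestor}(\ell_3)\rangle)\rightarrow P\text{ trusts }\langle D_2,O_2,\mathsf{sattestor}^*(\ell_3)\rangle$. - A4: $(\ell_1\succeq\ell_2\succeq\ell_3 \land P\text{ trusts }\langle D_1,O_1,\mathsf{sattestor}^*(\ell_1)\rangle \land P\text{ trusts }(D_1,O_1)\text{ says }\langle D_2,O_2,\mathsf{sattestor}(\ell_2)\rangle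 \land P\text{ trusts }(D_2,O_2)\text{ says }\langle D_3,O_3,\ell_3\rangle)\rightarrow P\text{ trusts }\langle D_2,O_2,\mathsf{sattestor}(\ell_3)\rangle$. - A5: $P\text{ trusts }\langle D,O,g\rangle\rightarrow P\text{ trusts }\langle D,O,\mathsf{bound}\rangle$. - A6: $(P\text{ trusts }(D,O)\text{ says }\varphi)\rightarrow (P\text{ trusts }(D,O)\text{ says }\langle D,O,\mathsf{bound}\rangle)$. - A7: $P\text{ trusts }\langle D,O,\mathsf{sattestor}^*(\ell)\rangle\rightarrow P\text{ trusts }\langle D,O,\mathsf{sattestor}(\ell)\rangle$. - A8: $P\text{ trusts }(D_1,O_1)\text{ says }\langle D_2,O_2,\mathsf{sattestor}^*(\ell)\rangle\rightarrow P\text{ trusts }(D_1,O_1)\text{ says }\langle D_2,O_2,\mathsf{sattestor}(\ell)\rangle$. - A9: $(\ell_1\succeq\ell_2\land P\text{ trusts }\langle D,O,\mathsf{sattestor}(\ell_1)\rangle)\rightarrow P\text{ trusts }\langle D,O,\mathsf{sattestor}(\ell_2)\rangle$. - A10: $(\ell_1\succeq\ell_2\land P\text{ trusts }\langle D,O,\mathsf{sattestor}^*(\ell_1)\rangle)\rightarrow P\text{ trusts }\langle D,O,\mathsf{sattestor}^*(\ell_2)\rangle$. - A11: $(D,O)\text{ says }\varphi\rightarrow (P\text{ trusts }(D,O)\text{ says }\varphi)$. - A12: (a) $(\varphi\land\psi)\rightarrow\varphi$; (b) $(\varphi\land\psi)\rightarrow(\psi\land\varphi)$; (c) $(\varphi\land(\psi\land\delta))\rightarrow((\varphi\land\psi)\land\delta)$.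 **Local axiom schemata** for $P$: - $\mathsf{DEL}(g_1,g_2)$: $P\text{ trusts }\langle D,O,g_1\rangle\rightarrow P\text{ trusts }\langle D,O,g_2\rangle$, for the given $g_1,g_2$ and any $D,O$. - $\mathsf{SATT}(D,O)$: $P\text{ trusts }\langle D,O,\mathsf{sattestor}(\ell)\rangle$, for the given $D,O$ and all labels $\ell$. - $\mathsf{SATT}^*(D,O)$: $P\text{ trusts }\langle D,O,\mathsf{sattestor}^*(\ell)\rangle$, for the given $D,O$ and all labels $\ell$. $\mathsf{LAS}_P$ is a finite set of instances of these. **Rules:** modus ponens and $\land$-introduction. "Derivable from $T$" means derivable by the rules from $T$, the axioms, and $\mathsf{LAS}_P$, with true order facts $\ell\preceq\ell'$ available as assumptions. "Derivable from $U$ in one step" means obtained by a single application of an axiom or local axiom to statements of $U$ (forming the conjunction of the antecedents, including true order facts, and applying modus ponens, or instantiating a local axiom). **Notation.** For a set $SF$ of statements/formulae, $\mathsf{labels}(SF)$ is the set of labels appearing in $SF$ and $\mathsf{IDs}(SF)$ the set of identities $(D,O)$ appearing in $SF$ (for $\mathsf{LAS}_P$: those appearing as parameters of its schema instances). For a label $g$, $\mathsf{blabel}(g)=\ell$ if $g$ is $\ell$, $\mathsf{sattestor}(\ell)$ or $\mathsf{sattestor}^*(\ell)$; $\mathsf{blabels}(\Gamma)=\{\mathsf{blabel}(g):g\in\Gamma\}$. For a set $\Gamma$ of labels, $\mathsf{lc}(\Gamma)$ is the set of all labels $g$ such that $\mathsf{blabel}(g)$ lies in the upward closure under $\prec$ of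 $\mathsf{blabels}(\Gamma)$; for a set $T$ of statements $\mathsf{lc}(T)=\mathsf{lc}(\mathsf{labels}(T))$. For a set $S$ of statements, $\mathsf{lc}(S,P)=\mathsf{lc}(\mathsf{labels}(S\cup\mathsf{LAS}_P))$. A set $S_1$ is $(S_0,P)$-limited if $\mathsf{labels}(S_1)\subseteq\mathsf{lc}(S_0,P)$ and $\mathsf{IDs}(S_1)\subseteq\mathsf{IDs}(S_0\cup\mathsf{LAS}_P)$. $\mathsf{maxlim}(S_1,S_0)$ is the maximal $(S_0,P)$-limited subset of $S_1$. A statement is sattestation-free (sattestor-free) if no label of the form $\mathsf{sattestor}(\ell)$ or $\mathsf{sattestor}^*(\ell)$ occurs in it; $\mathsf{sattfree}(S)$ is the set of sattestor-free elements of $S$. **Saturation algorithm** on input $T$. Let $\mathsf{All}$ be the set of all possible non-negated atomic statements (says-statements and $P$-trusts statements) and $S=\mathsf{maxlim}(\mathsf{All},T)$. 1. Initialize $\mathit{Present}:=T$, $\mathit{Past}:=\emptyset$, $\mathit{Rest}:=S\setminus\mathit{Present}$. 2. While $\mathit{Present}\ne\mathit{Past}$: set $U:=\mathit{Present}$, $V:=\mathit{Rest}$; set $U:=U\cup Q$ where $Q$ is the set of all elements of $V$ derivable from $U$ in one step; set $\mathit{Past}:=\mathit{Present}$, $\mathit{Present}:=U$, $\mathit{Rest}:=S\setminus\mathit{Present}$. 3. Set $\mathit{Resulta}=\mathit{Present}$, $\mathit{Resultb}=\mathsf{sattfree}(\mathit{Present})$, and return both.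
   Formalization: Bounds are lc(T,P) and IDs(T ∪ LAS_P), literal only if LAS_P adds no labels/IDs beyond lc(T)/IDs(T); bound counts as a label of every statement; IDs ignore the trusting subject; completeness covers says/P-trusts statements and excludes T empty with a SATT or SATT* instance. *)

theory Defs
  imports "HOL-Library.While_Combinator"
begin

text \<open>Sattestor-free labels: \<open>l1 < l2\<close> means that \<open>l1\<close> narrows \<open>l2\<close>.\<close>

class sat_label = order +
  fixes bound :: 'a
  assumes bound_incomparable: "l \<noteq> bound \<Longrightarrow> \<not> l \<le> bound \<and> \<not> bound \<le> l"
    and finite_broader: "finite {l'. l \<le> l'}"
    and linear_broader: "l \<le> l1 \<Longrightarrow> l \<le> l2 \<Longrightarrow> l1 \<le> l2 \<or> l2 \<le> l1"

datatype 'l glabel = Lab 'l | Satt 'l | SattStar 'l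

fun blabel :: "'l glabel \<Rightarrow> 'l" where
  "blabel (Lab l) = l"
| "blabel (Satt l) = l"
| "blabel (SattStar l) = l"

definition blabels :: "'l glabel set \<Rightarrow> 'l set" where
  "blabels G = blabel ` G"

text \<open>The three forms of principal are: an element of the given set of principals (the type
  \<open>'p\<close>), \<open>\<langle>D,O\<rangle>\<close>, and \<open>(D,O)\<close>.\<close>

datatype ('p, 'd, 'o) principal = Named 'p | BoundId 'd 'o | IdPair 'd 'o

text \<open>Onion addresses are written \<open>A\<close>, as \<open>O\<close> is infix syntax for relation composition.
  The unlabeled pair \<open>\<langle>D,O\<rangle>\<close> is \<open>BPair D A (Lab bound)\<close>.\<close>

datatype ('d, 'o, 'l) blpair = BPair 'd 'o "'l glabel"

datatype ('d, 'o, 'l) says_stmt = Says 'd 'o "('d, 'o, 'l) blpair"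

datatype ('d, 'o, 'l) trusted =
    TPair "('d, 'o, 'l) blpair"
  | TSays "('d, 'o, 'l) says_stmt"

datatype ('p, 'd, 'o, 'l) stmt =
    SaysSt "('d, 'o, 'l) says_stmt"
  | Trusts "('p, 'd, 'o) principal" "('d, 'o, 'l) trusted"

text \<open>\<open>Ord l l'\<close> is the formula \<open>l \<preceq> l'\<close> (equivalently \<open>l' \<succeq> l\<close>), as opposed to the fact
  \<open>l \<le> l'\<close>.\<close>

datatype ('p, 'd, 'o, 'l) form =
    St "('p, 'd, 'o, 'l) stmt"
  | Ord 'l 'l
  | Imp "('p, 'd, 'o, 'l) form" "('p, 'd, 'o, 'l) form"  (infixr "\<^bold>\<rightarrow>" 55)
  | And "('p, 'd, 'o, 'l) form" "('p, 'd, 'o, 'l) form"  (infixr "\<^bold>\<and>" 65)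

abbreviation trusts_pair ::
  "('p, 'd, 'o) principal \<Rightarrow> 'd \<Rightarrow> 'o \<Rightarrow> 'l glabel \<Rightarrow> ('p, 'd, 'o, 'l) form" where
  "trusts_pair P D A g \<equiv> St (Trusts P (TPair (BPair D A g)))"

abbreviation trusts_says ::
  "('p, 'd, 'o) principal \<Rightarrow> 'd \<Rightarrow> 'o \<Rightarrow> ('d, 'o, 'l) blpair \<Rightarrow> ('p, 'd, 'o, 'l) form" where
  "trusts_says P D A \<pi> \<equiv> St (Trusts P (TSays (Says D A \<pi>)))"

inductive ax :: "('p, 'd, 'o, 'l::sat_label) form \<Rightarrow> bool" where
  A1: "ax (Ord l2 l1 \<^bold>\<and> trusts_pair P D A (Lab l2) \<^bold>\<rightarrow> trusts_pair P D A (Lab l1))"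
| A2: "ax (Ord l2 l1 \<^bold>\<and> Ord l3 l2 \<^bold>\<and> trusts_pair P D1 A1 (Satt l1)
          \<^bold>\<and> trusts_says P D1 A1 (BPair D2 A2 (Lab l2))
          \<^bold>\<and> trusts_says P D2 A2 (BPair D2 A2 (Lab l3))
        \<^bold>\<rightarrow> trusts_pair P D2 A2 (Lab l2))"
| A3: "ax (Ord l2 l1 \<^bold>\<and> Ord l3 l2 \<^bold>\<and> trusts_pair P D1 A1 (SattStar l1)
          \<^bold>\<and> trusts_says P D1 A1 (BPair D2 A2 (SattStar l2))
          \<^bold>\<and> trusts_says P D2 A2 (BPair D3 A3 (Satt l3))
        \<^bold>\<rightarrow> trusts_pair P D2 A2 (SattStar l3))"
| A4: "ax (Ord l2 l1 \<^bold>\<and> Ord l3 l2 \<^bold>\<and> trusts_pair P D1 A1 (SattStar l1)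
          \<^bold>\<and> trusts_says P D1 A1 (BPair D2 A2 (Satt l2))
          \<^bold>\<and> trusts_says P D2 A2 (BPair D3 A3 (Lab l3))
        \<^bold>\<rightarrow> trusts_pair P D2 A2 (Satt l3))"
| A5: "ax (trusts_pair P D A g \<^bold>\<rightarrow> trusts_pair P D A (Lab bound))"
| A6: "ax (trusts_says P D A \<pi> \<^bold>\<rightarrow> trusts_says P D A (BPair D A (Lab bound)))"
| A7: "ax (trusts_pair P D A (SattStar l) \<^bold>\<rightarrow> trusts_pair P D A (Satt l))"
| A8: "ax (trusts_says P D1 A1 (BPair D2 A2 (SattStar l))
        \<^bold>\<rightarrow> trusts_says P D1 A1 (BPair D2 A2 (Satt l)))"
| A9: "ax (Ord l2 l1 \<^bold>\<and> trusts_pair P D A (Satt l1) \<^bold>\<rightarrow> trusts_pair P D A (Satt l2))"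
| A10: "ax (Ord l2 l1 \<^bold>\<and> trusts_pair P D A (SattStar l1) \<^bold>\<rightarrow> trusts_pair P D A (SattStar l2))"
| A11: "ax (St (SaysSt (Says D A \<pi>)) \<^bold>\<rightarrow> trusts_says P D A \<pi>)"
| A12a: "ax ((\<phi> \<^bold>\<and> \<psi>) \<^bold>\<rightarrow> \<phi>)"
| A12b: "ax ((\<phi> \<^bold>\<and> \<psi>) \<^bold>\<rightarrow> (\<psi> \<^bold>\<and> \<phi>))"
| A12c: "ax ((\<phi> \<^bold>\<and> (\<psi> \<^bold>\<and> \<delta>)) \<^bold>\<rightarrow> ((\<phi> \<^bold>\<and> \<psi>) \<^bold>\<and> \<delta>))"

text \<open>An element of \<open>LAS\<^sub>P\<close> is a schema together with its parameters; \<open>las_ax\<close> gives the local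
  axioms it stands for, in which \<open>D, O\<close> (for \<open>DEL\<close>) and the label (for \<open>SATT\<close>, \<open>SATTStar\<close>)
  remain arbitrary.\<close>

datatype ('d, 'o, 'l) schema =
    DEL "'l glabel" "'l glabel"
  | SATT 'd 'o
  | SATTStar 'd 'o

inductive las_ax ::
  "('p, 'd, 'o) principal \<Rightarrow> ('d, 'o, 'l) schema set \<Rightarrow> ('p, 'd, 'o, 'l) form \<Rightarrow> bool"
  for P LAS where
  "DEL g1 g2 \<in> LAS \<Longrightarrow> las_ax P LAS (trusts_pair P D A g1 \<^bold>\<rightarrow> trusts_pair P D A g2)"
| "SATT D A \<in> LAS \<Longrightarrow> las_ax P LAS (trusts_pair P D A (Satt l))"
| "SATTStar D A \<in> LAS \<Longrightarrow> las_ax P LAS (trusts_pair P D A (SattStar l))"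

inductive derivable ::
  "('p, 'd, 'o) principal \<Rightarrow> ('d, 'o, 'l::sat_label) schema set \<Rightarrow> ('p, 'd, 'o, 'l) stmt set
    \<Rightarrow> ('p, 'd, 'o, 'l) form \<Rightarrow> bool"
  for P LAS T where
  premise: "s \<in> T \<Longrightarrow> derivable P LAS T (St s)"
| order_fact: "l \<le> l' \<Longrightarrow> derivable P LAS T (Ord l l')"
| axiom: "ax \<phi> \<Longrightarrow> derivable P LAS T \<phi>"
| local_axiom: "las_ax P LAS \<phi> \<Longrightarrow> derivable P LAS T \<phi>"
| modus_ponens:
    "derivable P LAS T (\<phi> \<^bold>\<rightarrow> \<psi>) \<Longrightarrow> derivable P LAS T \<phi> \<Longrightarrow> derivable P LAS T \<psi>"
| conj_intro:
    "derivable P LAS T \<phi> \<Longrightarrow> derivable P LAS T \<psi> \<Longrightarrow> derivable P LAS T (\<phi> \<^bold>\<and> \<psi>)"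

inductive antecedent :: "('p, 'd, 'o, 'l::sat_label) stmt set \<Rightarrow> ('p, 'd, 'o, 'l) form \<Rightarrow> bool"
  for U where
  "s \<in> U \<Longrightarrow> antecedent U (St s)"
| "l \<le> l' \<Longrightarrow> antecedent U (Ord l l')"
| "antecedent U \<phi> \<Longrightarrow> antecedent U \<psi> \<Longrightarrow> antecedent U (\<phi> \<^bold>\<and> \<psi>)"

definition one_step ::
  "('p, 'd, 'o) principal \<Rightarrow> ('d, 'o, 'l::sat_label) schema set \<Rightarrow> ('p, 'd, 'o, 'l) stmt set
    \<Rightarrow> ('p, 'd, 'o, 'l) stmt \<Rightarrow> bool" where
  "one_step P LAS U s \<longleftrightarrow>
     (\<exists>\<phi>. antecedent U \<phi> \<and> (ax (\<phi> \<^bold>\<rightarrow> St s) \<or> las_ax P LAS (\<phi> \<^bold>\<rightarrow> St s))) \<or> las_ax P LAS (St s)"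

text \<open>The labels written in a statement. In particular \<open>sattestor(\<ell>)\<close> contributes itself, not
  \<open>\<ell>\<close>.\<close>

fun pair_glabels :: "('d, 'o, 'l) blpair \<Rightarrow> 'l glabel set" where
  "pair_glabels (BPair D A g) = {g}"

fun says_glabels :: "('d, 'o, 'l) says_stmt \<Rightarrow> 'l glabel set" where
  "says_glabels (Says D A \<pi>) = pair_glabels \<pi>"

fun trusted_glabels :: "('d, 'o, 'l) trusted \<Rightarrow> 'l glabel set" where
  "trusted_glabels (TPair \<pi>) = pair_glabels \<pi>"
| "trusted_glabels (TSays \<sigma>) = says_glabels \<sigma>"

fun stmt_glabels :: "('p, 'd, 'o, 'l) stmt \<Rightarrow> 'l glabel set" where
  "stmt_glabels (SaysSt \<sigma>) = says_glabels \<sigma>"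
| "stmt_glabels (Trusts P \<chi>) = trusted_glabels \<chi>"

text \<open>Every pair \<open>\<langle>D,O,g\<rangle>\<close> is a bound pair, \<open>\<langle>D,O\<rangle>\<close> being synonymous with \<open>\<langle>D,O,bound\<rangle>\<close>;
  so \<open>bound\<close> counts as appearing in every statement, even where \<open>g\<close> is the only label written.
  This matters because \<open>A5\<close> and \<open>A6\<close> introduce \<open>bound\<close>, which is not above any other label: if it
  did not count, the label bound on the saturation space would cut off their conclusions.\<close>

definition labels :: "('p, 'd, 'o, 'l::sat_label) stmt set \<Rightarrow> 'l glabel set" where
  "labels S = (\<Union>s\<in>S. insert (Lab bound) (stmt_glabels s))"

fun schema_labels :: "('d, 'o, 'l) schema \<Rightarrow> 'l glabel set" where
  "schema_labels (DEL g1 g2) = {g1, g2}"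
| "schema_labels (SATT D A) = {}"
| "schema_labels (SATTStar D A) = {}"

definition las_labels :: "('d, 'o, 'l) schema set \<Rightarrow> 'l glabel set" where
  "las_labels LAS = (\<Union>s\<in>LAS. schema_labels s)"

text \<open>The identities in a statement are those it speaks about; the trusting principal on the left
  of \<open>trusts\<close> is not counted, even if it has the form \<open>(D,O)\<close>.\<close>

fun pair_IDs :: "('d, 'o, 'l) blpair \<Rightarrow> ('d \<times> 'o) set" where
  "pair_IDs (BPair D A g) = {(D, A)}"

fun says_IDs :: "('d, 'o, 'l) says_stmt \<Rightarrow> ('d \<times> 'o) set" where
  "says_IDs (Says D A \<pi>) = insert (D, A) (pair_IDs \<pi>)"

fun trusted_IDs :: "('d, 'o, 'l) trusted \<Rightarrow> ('d \<times> 'o) set" where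
  "trusted_IDs (TPair \<pi>) = pair_IDs \<pi>"
| "trusted_IDs (TSays \<sigma>) = says_IDs \<sigma>"

fun stmt_IDs :: "('p, 'd, 'o, 'l) stmt \<Rightarrow> ('d \<times> 'o) set" where
  "stmt_IDs (SaysSt \<sigma>) = says_IDs \<sigma>"
| "stmt_IDs (Trusts P \<chi>) = trusted_IDs \<chi>"

definition IDs :: "('p, 'd, 'o, 'l) stmt set \<Rightarrow> ('d \<times> 'o) set" where
  "IDs S = (\<Union>s\<in>S. stmt_IDs s)"

fun schema_IDs :: "('d, 'o, 'l) schema \<Rightarrow> ('d \<times> 'o) set" where
  "schema_IDs (DEL g1 g2) = {}"
| "schema_IDs (SATT D A) = {(D, A)}"
| "schema_IDs (SATTStar D A) = {(D, A)}"

definition las_IDs :: "('d, 'o, 'l) schema set \<Rightarrow> ('d \<times> 'o) set" where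
  "las_IDs LAS = (\<Union>s\<in>LAS. schema_IDs s)"

definition lc :: "'l::order glabel set \<Rightarrow> 'l glabel set" where
  "lc G = {g. \<exists>l\<in>blabels G. l \<le> blabel g}"

definition lcP :: "('p, 'd, 'o, 'l::sat_label) stmt set \<Rightarrow> ('d, 'o, 'l) schema set \<Rightarrow> 'l glabel set"
  where "lcP S LAS = lc (labels S \<union> las_labels LAS)"

definition limited ::
  "('d, 'o, 'l::sat_label) schema set \<Rightarrow> ('p, 'd, 'o, 'l) stmt set \<Rightarrow> ('p, 'd, 'o, 'l) stmt set
    \<Rightarrow> bool" where
  "limited LAS S0 S1 \<longleftrightarrow> labels S1 \<subseteq> lcP S0 LAS \<and> IDs S1 \<subseteq> IDs S0 \<union> las_IDs LAS"

definition maxlim ::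
  "('d, 'o, 'l::sat_label) schema set \<Rightarrow> ('p, 'd, 'o, 'l) stmt set \<Rightarrow> ('p, 'd, 'o, 'l) stmt set
    \<Rightarrow> ('p, 'd, 'o, 'l) stmt set" where
  "maxlim LAS S1 S0 = \<Union>{X. X \<subseteq> S1 \<and> limited LAS S0 X}"

lemma maxlim_greatest:
  fixes S0 S1 :: "('p, 'd, 'o, 'l::sat_label) stmt set"
  shows
  "maxlim LAS S1 S0 \<subseteq> S1" "limited LAS S0 (maxlim LAS S1 S0)"
  "X \<subseteq> S1 \<Longrightarrow> limited LAS S0 X \<Longrightarrow> X \<subseteq> maxlim LAS S1 S0"
proof -
  show "maxlim LAS S1 S0 \<subseteq> S1" unfolding maxlim_def by blast
  show "X \<subseteq> S1 \<Longrightarrow> limited LAS S0 X \<Longrightarrow> X \<subseteq> maxlim LAS S1 S0"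
    unfolding maxlim_def by blast
  have "labels (\<Union>\<X>) = (\<Union>X\<in>\<X>. labels X)" "IDs (\<Union>\<X>) = (\<Union>X\<in>\<X>. IDs X)"
    for \<X> :: "('p, 'd, 'o, 'l::sat_label) stmt set set"
    unfolding labels_def IDs_def by blast+
  then show "limited LAS S0 (maxlim LAS S1 S0)"
    unfolding maxlim_def limited_def by (simp only:) blast
qed

definition satt_free :: "('p, 'd, 'o, 'l) stmt \<Rightarrow> bool" where
  "satt_free s \<longleftrightarrow> (\<forall>l. Satt l \<notin> stmt_glabels s \<and> SattStar l \<notin> stmt_glabels s)"

definition sattfree :: "('p, 'd, 'o, 'l) stmt set \<Rightarrow> ('p, 'd, 'o, 'l) stmt set" where
  "sattfree S = {s \<in> S. satt_free s}"

definition All_stmts :: "('p, 'd, 'o) principal \<Rightarrow> ('p, 'd, 'o, 'l) stmt set" where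
  "All_stmts P = range SaysSt \<union> range (Trusts P)"

definition saturation_round ::
  "('p, 'd, 'o) principal \<Rightarrow> ('d, 'o, 'l::sat_label) schema set \<Rightarrow> ('p, 'd, 'o, 'l) stmt set
    \<Rightarrow> ('p, 'd, 'o, 'l) stmt set \<times> ('p, 'd, 'o, 'l) stmt set \<times> ('p, 'd, 'o, 'l) stmt set
    \<Rightarrow> ('p, 'd, 'o, 'l) stmt set \<times> ('p, 'd, 'o, 'l) stmt set \<times> ('p, 'd, 'o, 'l) stmt set" where
  "saturation_round P LAS S = (\<lambda>(Present, Past, Rest).
     let U = Present \<union> {s \<in> Rest. one_step P LAS Present s} in (U, Present, S - U))"

text \<open>The result is \<open>None\<close> if the loop runs forever, and otherwise \<open>Some (Resulta, Resultb)\<close>.\<close>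

definition saturate ::
  "('p, 'd, 'o) principal \<Rightarrow> ('d, 'o, 'l::sat_label) schema set \<Rightarrow> ('p, 'd, 'o, 'l) stmt set
    \<Rightarrow> (('p, 'd, 'o, 'l) stmt set \<times> ('p, 'd, 'o, 'l) stmt set) option" where
  "saturate P LAS T =
     (let S = maxlim LAS (All_stmts P) T in
      map_option (\<lambda>(Present, Past, Rest). (Present, sattfree Present))
        (while_option (\<lambda>(Present, Past, Rest). Present \<noteq> Past)
          (saturation_round P LAS S) (T, {}, S - T)))"

end

theory Submission imports Defs
begin

text \<open>Completeness is proved semantically. A saturated set \<open>R\<close> is extended to a set of statements
  that makes every axiom and every local axiom true, so that everything derivable is true in it.
  Statements of principals other than \<open>P\<close> are all made true. A sattestor label of \<open>P\<close> outside
  \<open>lcP T LAS\<close>, which \<open>SATT\<close> or \<open>A9\<close> may introduce, is made true wherever the \<open>bound\<close> pair of the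
  same identity is in \<open>R\<close>, which is what \<open>A5\<close> demands. No such label ever contributes to a
  conclusion within \<open>lcP T LAS\<close>: this set is closed upwards, whereas \<open>A9\<close> and \<open>A10\<close> pass to narrower
  labels, the labels of \<open>DEL\<close> lie in it, and in \<open>A2\<close> to \<open>A4\<close> the sattestor label is broader than the
  label of a says-statement, and the latter lies in it.\<close>

section \<open>Upward closure of label sets\<close>

lemma lc_increasing: "G \<subseteq> lc G"
  unfolding lc_def blabels_def by blast

lemma lc_upward: "g \<in> lc G \<Longrightarrow> blabel g \<le> blabel h \<Longrightarrow> h \<in> lc G"
  unfolding lc_def using order_trans by blast

lemma lc_least: "G \<subseteq> lc H \<Longrightarrow> lc G \<subseteq> lc H"
  unfolding lc_def blabels_def by (auto intro: order_trans)

lemma finite_blabel_vimage: "finite L \<Longrightarrow> finite {g. blabel g \<in> L}"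
proof -
  assume L: "finite L"
  have "{g. blabel g \<in> L} \<subseteq> Lab ` L \<union> Satt ` L \<union> SattStar ` L"
  proof
    fix g assume "g \<in> {g. blabel g \<in> L}"
    then show "g \<in> Lab ` L \<union> Satt ` L \<union> SattStar ` L" by (cases g) auto
  qed
  with L show ?thesis by (meson finite_UnI finite_imageI finite_subset)
qed

text \<open>Each base label has finitely many broader ones, and a base label carries only three
  labels.\<close>

lemma finite_lc:
  fixes G :: "'l::sat_label glabel set"
  assumes "finite G"
  shows "finite (lc G)"
proof -
  have "lc G = {g. blabel g \<in> (\<Union>l\<in>blabels G. {l'. l \<le> l'})}"
    unfolding lc_def by blast
  moreover have "finite (\<Union>l\<in>blabels G. {l'. l \<le> l'})"
    using assms finite_broader unfolding blabels_def by blast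
  ultimately show ?thesis
    using finite_blabel_vimage by metis
qed

section \<open>Finiteness of the saturation space\<close>

lemma stmt_cases [case_names says trusts_pair trusts_says]:
  obtains D A D' A' g where "s = SaysSt (Says D A (BPair D' A' g))"
  | Q D A g where "s = Trusts Q (TPair (BPair D A g))"
  | Q D A D' A' g where "s = Trusts Q (TSays (Says D A (BPair D' A' g)))"
  by (metis stmt.exhaust trusted.exhaust says_stmt.exhaust blpair.exhaust)

lemma finite_stmt_glabels: "finite (stmt_glabels s)"
  by (cases s rule: stmt_cases) auto

lemma finite_stmt_IDs: "finite (stmt_IDs s)"
  by (cases s rule: stmt_cases) auto

text \<open>Serves the case without any identities, where the saturation space is empty.\<close>

lemma stmt_IDs_nonempty: "stmt_IDs s \<noteq> {}"
  by (cases s rule: stmt_cases) auto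

lemma finite_schema_labels: "finite (schema_labels x)"
  by (cases x) auto

lemma finite_schema_IDs: "finite (schema_IDs x)"
  by (cases x) auto

lemma finite_lcP: "finite T \<Longrightarrow> finite LAS \<Longrightarrow> finite (lcP T LAS)"
  unfolding lcP_def labels_def las_labels_def
  by (intro finite_lc finite_UnI finite_UN_I finite.insertI finite_stmt_glabels
      finite_schema_labels)

lemma finite_all_IDs: "finite T \<Longrightarrow> finite LAS \<Longrightarrow> finite (IDs T \<union> las_IDs LAS)"
  unfolding IDs_def las_IDs_def
  by (intro finite_UnI finite_UN_I finite_stmt_IDs finite_schema_IDs)

text \<open>Being limited is a condition on each statement separately. The conjunct on
  \<open>Lab bound\<close> comes from the convention that \<open>bound\<close> occurs in every
  statement.\<close>

lemma mem_maxlim: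
  "s \<in> maxlim LAS X T \<longleftrightarrow>
     s \<in> X \<and> Lab bound \<in> lcP T LAS \<and> stmt_glabels s \<subseteq> lcP T LAS
     \<and> stmt_IDs s \<subseteq> IDs T \<union> las_IDs LAS"
proof
  assume s: "s \<in> maxlim LAS X T"
  from maxlim_greatest(2)[of LAS T X] s
  show "s \<in> X \<and> Lab bound \<in> lcP T LAS \<and> stmt_glabels s \<subseteq> lcP T LAS
     \<and> stmt_IDs s \<subseteq> IDs T \<union> las_IDs LAS"
    using maxlim_greatest(1)[of LAS X T] unfolding limited_def labels_def IDs_def by blast
next
  assume "s \<in> X \<and> Lab bound \<in> lcP T LAS \<and> stmt_glabels s \<subseteq> lcP T LAS
     \<and> stmt_IDs s \<subseteq> IDs T \<union> las_IDs LAS"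
  then have "{s} \<subseteq> X" "limited LAS T {s}"
    unfolding limited_def labels_def IDs_def by auto
  then show "s \<in> maxlim LAS X T"
    using maxlim_greatest(3) by blast
qed

lemma maxlim_extends: "T \<subseteq> X \<Longrightarrow> T \<subseteq> maxlim LAS X T"
  using lc_increasing[of "labels T \<union> las_labels LAS"]
  by (intro maxlim_greatest(3)) (auto simp: limited_def lcP_def)

text \<open>A statement of \<open>All_stmts P\<close> is fixed by its form, at most two identities
  and one label, since the trusting principal can only be \<open>P\<close>.\<close>

lemma finite_limited_stmts:
  fixes T :: "('p, 'd, 'o, 'l::sat_label) stmt set"
  assumes "finite T" "finite LAS"
  shows "finite (maxlim LAS (All_stmts P) T)"
proof -
  let ?L = "lcP T LAS" and ?I = "IDs T \<union> las_IDs LAS"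
  let ?pairs = "(\<lambda>((D, A), g). BPair D A g) ` (?I \<times> ?L)"
  let ?says = "(\<lambda>((D, A), \<pi>). Says D A \<pi>) ` (?I \<times> ?pairs)"
  let ?all = "SaysSt ` ?says \<union> Trusts P ` (TPair ` ?pairs \<union> TSays ` ?says)"
  have pairs: "BPair D A g \<in> ?pairs" if "g \<in> ?L" "(D, A) \<in> ?I" for D A g
    using that by (intro image_eqI[of _ _ "((D, A), g)"]) auto
  have says_in: "Says D A \<pi> \<in> ?says" if "(D, A) \<in> ?I" "\<pi> \<in> ?pairs" for D A \<pi>
    using that by (intro image_eqI[of _ _ "((D, A), \<pi>)"]) auto
  have "maxlim LAS (All_stmts P) T \<subseteq> ?all"
  proof
    fix s assume "s \<in> maxlim LAS (All_stmts P) T"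
    then have s: "s \<in> All_stmts P" "stmt_glabels s \<subseteq> ?L" "stmt_IDs s \<subseteq> ?I"
      by (auto simp: mem_maxlim)
    then show "s \<in> ?all"
    proof (cases s rule: stmt_cases)
      case (says D A D' A' g)
      with s have "Says D A (BPair D' A' g) \<in> ?says" by (intro says_in pairs) simp_all
      with says show ?thesis by blast
    next
      case (trusts_pair Q D A g)
      with s have "BPair D A g \<in> ?pairs" by (intro pairs) simp_all
      with trusts_pair s show ?thesis unfolding All_stmts_def by blast
    next
      case (trusts_says Q D A D' A' g)
      with s have "Says D A (BPair D' A' g) \<in> ?says" by (intro says_in pairs) simp_all
      with trusts_says s show ?thesis unfolding All_stmts_def by blast
    qed
  qed
  moreover have "finite ?all"
    using finite_lcP[OF assms] finite_all_IDs[OF assms] by blast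
  ultimately show ?thesis
    by (rule finite_subset)
qed

section \<open>Soundness of a single step\<close>

lemma antecedent_derivable:
  "antecedent U \<phi> \<Longrightarrow> \<forall>s\<in>U. derivable P LAS T (St s) \<Longrightarrow> derivable P LAS T \<phi>"
  by (induction rule: antecedent.induct) (auto intro: derivable.intros)

lemma one_step_derivable:
  "one_step P LAS U s \<Longrightarrow> \<forall>s\<in>U. derivable P LAS T (St s) \<Longrightarrow> derivable P LAS T (St s)"
  unfolding one_step_def
  by (meson antecedent_derivable derivable.axiom derivable.local_axiom derivable.modus_ponens)

section \<open>Truth of formulae in a set of statements\<close>

primrec form_true :: "('p, 'd, 'o, 'l::order) stmt set \<Rightarrow> ('p, 'd, 'o, 'l) form \<Rightarrow> bool" where
  "form_true M (St s) \<longleftrightarrow> s \<in> M"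
| "form_true M (Ord l l') \<longleftrightarrow> l \<le> l'"
| "form_true M (\<phi> \<^bold>\<rightarrow> \<psi>) \<longleftrightarrow> (form_true M \<phi> \<longrightarrow> form_true M \<psi>)"
| "form_true M (\<phi> \<^bold>\<and> \<psi>) \<longleftrightarrow> form_true M \<phi> \<and> form_true M \<psi>"

text \<open>Both rules preserve truth, and assumed order facts are true by the reading of
  \<open>Ord\<close>.\<close>

lemma derivable_true:
  assumes "derivable P LAS T \<phi>" and "T \<subseteq> M"
    and "\<And>\<phi>. ax \<phi> \<Longrightarrow> form_true M \<phi>" and "\<And>\<phi>. las_ax P LAS \<phi> \<Longrightarrow> form_true M \<phi>"
  shows "form_true M \<phi>"
  using assms by (induction rule: derivable.induct) auto

section \<open>The extension of a saturated set\<close>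

text \<open>\<open>Lab\<close> labels outside \<open>L\<close> still require membership in
  \<open>R\<close>, so that sattestor-free trust statements of \<open>P\<close> gain nothing.
  Trusted says-statements of \<open>P\<close> are taken from \<open>R\<close> unchanged:
  \<open>A6\<close>, \<open>A8\<close> and \<open>A11\<close>, which conclude them, introduce only
  \<open>bound\<close> or keep the base label, and so do not leave \<open>L\<close>.\<close>

fun in_extension :: "('p, 'd, 'o) principal \<Rightarrow> 'l::sat_label glabel set \<Rightarrow> ('p, 'd, 'o, 'l) stmt set
    \<Rightarrow> ('p, 'd, 'o, 'l) stmt \<Rightarrow> bool" where
  "in_extension P L R (SaysSt \<sigma>) \<longleftrightarrow> SaysSt \<sigma> \<in> R"
| "in_extension P L R (Trusts Q (TSays \<sigma>)) \<longleftrightarrow> (Q = P \<longrightarrow> Trusts P (TSays \<sigma>) \<in> R)"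
| "in_extension P L R (Trusts Q (TPair (BPair D A g))) \<longleftrightarrow>
     (Q = P \<longrightarrow>
       (if g \<in> L \<or> g \<in> range Lab then Trusts P (TPair (BPair D A g)) \<in> R
        else Trusts P (TPair (BPair D A (Lab bound))) \<in> R))"

text \<open>\<open>closed\<close> speaks only of conclusions within the saturation space.
  \<open>nonempty\<close> secures \<open>Lab bound \<in> L\<close> whenever a schema names an
  identity, so that the \<open>A5\<close> consequences of its instances lie in that space.\<close>

locale saturated =
  fixes P :: "('p, 'd, 'o) principal"
    and LAS :: "('d, 'o, 'l::sat_label) schema set"
    and T R :: "('p, 'd, 'o, 'l) stmt set"
  assumes T_subset: "T \<subseteq> R"
    and R_limited: "R \<subseteq> maxlim LAS (All_stmts P) T"
    and closed: "s \<in> maxlim LAS (All_stmts P) T \<Longrightarrow> one_step P LAS R s \<Longrightarrow> s \<in> R"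
    and nonempty: "T = {} \<Longrightarrow> las_IDs LAS = {}"
begin

abbreviation "L \<equiv> lcP T LAS"
abbreviation "I \<equiv> IDs T \<union> las_IDs LAS"
abbreviation "M \<equiv> {s. in_extension P L R s}"

lemma L_upward: "g \<in> L \<Longrightarrow> blabel g \<le> blabel h \<Longrightarrow> h \<in> L"
  unfolding lcP_def by (rule lc_upward)

text \<open>Reduces the use of an axiom to checking that its conclusion stays within the saturation
  space.\<close>

lemma ax_closed:
  assumes "ax (\<phi> \<^bold>\<rightarrow> St s)" "antecedent R \<phi>"
    and "s \<in> All_stmts P" "Lab bound \<in> L" "stmt_glabels s \<subseteq> L" "stmt_IDs s \<subseteq> I"
  shows "s \<in> R"
  using assms by (intro closed) (auto simp: mem_maxlim one_step_def)

lemma trusts_in_All: "Trusts P \<chi> \<in> All_stmts P"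
  unfolding All_stmts_def by blast

lemma R_pair:
  assumes "Trusts P (TPair (BPair D A g)) \<in> R"
  shows "g \<in> L" "Lab bound \<in> L" "(D, A) \<in> I"
  using assms R_limited by (auto simp: mem_maxlim)

lemma R_says:
  assumes "SaysSt (Says D1 A1 (BPair D2 A2 g)) \<in> R
    \<or> Trusts P (TSays (Says D1 A1 (BPair D2 A2 g))) \<in> R"
  shows "g \<in> L" "Lab bound \<in> L" "(D1, A1) \<in> I" "(D2, A2) \<in> I"
  using assms R_limited by (auto simp: mem_maxlim)

lemma R_bound:
  assumes "Trusts P (TPair (BPair D A g)) \<in> R"
  shows "Trusts P (TPair (BPair D A (Lab bound))) \<in> R"
  using R_pair[OF assms] assms
  by (intro ax_closed[OF ax.A5[of P D A g]]) (auto intro!: antecedent.intros trusts_in_All)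

lemma satt_in_M:
  assumes "g \<in> L \<Longrightarrow> Trusts P (TPair (BPair D A g)) \<in> R"
    and "g \<notin> range Lab" and "Trusts P (TPair (BPair D A (Lab bound))) \<in> R"
  shows "Trusts P (TPair (BPair D A g)) \<in> M"
  using assms by auto

text \<open>For pairs taken from \<open>R\<close> this is \<open>A5\<close>; for sattestor labels
  outside \<open>L\<close> it is the defining condition of the extension.\<close>

lemma M_bound: "Trusts P (TPair (BPair D A g)) \<in> M \<Longrightarrow> Trusts P (TPair (BPair D A (Lab bound))) \<in> R"
  using R_bound by (auto split: if_splits)

lemma M_limited: "Trusts P (TPair (BPair D A g)) \<in> M \<Longrightarrow> g \<in> L \<Longrightarrow> Trusts P (TPair (BPair D A g)) \<in> R"
  by auto

text \<open>Labels of statements in \<open>R\<close> lie in \<open>L\<close>, so the default clause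
  for sattestor labels is never reached.\<close>

lemma R_in_M: "R \<subseteq> M"
proof
  fix s assume "s \<in> R"
  moreover from this have "Lab bound \<in> L" using R_limited by (auto simp: mem_maxlim)
  ultimately show "s \<in> M"
    by (cases "(P, L, R, s)" rule: in_extension.cases) (auto dest: R_pair)
qed

lemma other_principal_in_M: "Q \<noteq> P \<Longrightarrow> Trusts Q \<chi> \<in> M"
  by (cases "(P, L, R, Trusts Q \<chi>)" rule: in_extension.cases) auto

section \<open>Truth of the axioms in the extension\<close>

lemma ax_true:
  assumes "ax \<phi>"
  shows "form_true M \<phi>"
  using assms
proof cases
  case (A1 l2 l1 Q D A)
  have "Trusts P (TPair (BPair D A (Lab l1))) \<in> R"
    if "l2 \<le> l1" and R: "Trusts P (TPair (BPair D A (Lab l2))) \<in> R"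
    using R_pair[OF R] that L_upward[of "Lab l2" "Lab l1"]
    by (intro ax_closed[OF ax.A1[of l2 l1]]) (auto intro!: antecedent.intros trusts_in_All)
  with A1 show ?thesis by auto
next
  case (A2 l2 l1 l3 Q D1 A1 D2 A2)
  \<comment> \<open>\<open>R1\<close> puts \<open>Lab l2\<close> into \<open>L\<close>, hence also
    the broader \<open>Satt l1\<close>. The premise from \<open>M\<close> therefore already lies in
    \<open>R\<close>, and the axiom applies there.\<close>
  have "Trusts P (TPair (BPair D2 A2 (Lab l2))) \<in> R"
    if "l2 \<le> l1" "l3 \<le> l2" and M: "Trusts P (TPair (BPair D1 A1 (Satt l1))) \<in> M"
      and R1: "Trusts P (TSays (Says D1 A1 (BPair D2 A2 (Lab l2)))) \<in> R"
      and R2: "Trusts P (TSays (Says D2 A2 (BPair D2 A2 (Lab l3)))) \<in> R"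
    using R_says[of D1 A1 D2 A2 "Lab l2"] that M_limited[OF M] L_upward[of "Lab l2" "Satt l1"]
    by (intro ax_closed[OF ax.A2[of l2 l1 l3 P D1 A1]])
      (auto intro!: antecedent.intros trusts_in_All simp del: Un_iff)
  with A2 show ?thesis by auto
next
  case (A3 l2 l1 l3 Q D1 A1 D2 A2 D3 A3)
  \<comment> \<open>The conclusion is within the space because \<open>R2\<close> gives
    \<open>Satt l3 \<in> L\<close>, and \<open>SattStar l3\<close> has the same base label.\<close>
  have "Trusts P (TPair (BPair D2 A2 (SattStar l3))) \<in> R"
    if "l2 \<le> l1" "l3 \<le> l2" and M: "Trusts P (TPair (BPair D1 A1 (SattStar l1))) \<in> M"
      and R1: "Trusts P (TSays (Says D1 A1 (BPair D2 A2 (SattStar l2)))) \<in> R"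
      and R2: "Trusts P (TSays (Says D2 A2 (BPair D3 A3 (Satt l3)))) \<in> R"
    using R_says[of D1 A1 D2 A2 "SattStar l2"] R_says[of D2 A2 D3 A3 "Satt l3"] that
      M_limited[OF M] L_upward[of "SattStar l2" "SattStar l1"] L_upward[of "Satt l3" "SattStar l3"]
    by (intro ax_closed[OF ax.A3[of l2 l1 l3 P D1 A1 D2 A2 D3 A3]])
      (auto intro!: antecedent.intros trusts_in_All simp del: Un_iff)
  then have "Trusts Q (TPair (BPair D2 A2 (SattStar l3))) \<in> M"
    if "l2 \<le> l1" "l3 \<le> l2" and "Trusts Q (TPair (BPair D1 A1 (SattStar l1))) \<in> M"
      and "Trusts Q (TSays (Says D1 A1 (BPair D2 A2 (SattStar l2)))) \<in> M"
      and "Trusts Q (TSays (Says D2 A2 (BPair D3 A3 (Satt l3)))) \<in> M"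
    using that R_in_M other_principal_in_M by
      (cases "Q = P") (fastforce simp del: in_extension.simps(3))+
  with A3 show ?thesis by (simp del: in_extension.simps)
next
  case (A4 l2 l1 l3 Q D1 A1 D2 A2 D3 A3)
  have "Trusts P (TPair (BPair D2 A2 (Satt l3))) \<in> R"
    if "l2 \<le> l1" "l3 \<le> l2" and M: "Trusts P (TPair (BPair D1 A1 (SattStar l1))) \<in> M"
      and R1: "Trusts P (TSays (Says D1 A1 (BPair D2 A2 (Satt l2)))) \<in> R"
      and R2: "Trusts P (TSays (Says D2 A2 (BPair D3 A3 (Lab l3)))) \<in> R"
    using R_says[of D1 A1 D2 A2 "Satt l2"] R_says[of D2 A2 D3 A3 "Lab l3"] that
      M_limited[OF M] L_upward[of "Satt l2" "SattStar l1"] L_upward[of "Lab l3" "Satt l3"]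
    by (intro ax_closed[OF ax.A4[of l2 l1 l3 P D1 A1 D2 A2 D3 A3]])
      (auto intro!: antecedent.intros trusts_in_All simp del: Un_iff)
  then have "Trusts Q (TPair (BPair D2 A2 (Satt l3))) \<in> M"
    if "l2 \<le> l1" "l3 \<le> l2" and "Trusts Q (TPair (BPair D1 A1 (SattStar l1))) \<in> M"
      and "Trusts Q (TSays (Says D1 A1 (BPair D2 A2 (Satt l2)))) \<in> M"
      and "Trusts Q (TSays (Says D2 A2 (BPair D3 A3 (Lab l3)))) \<in> M"
    using that R_in_M other_principal_in_M by
      (cases "Q = P") (fastforce simp del: in_extension.simps(3))+
  with A4 show ?thesis by (simp del: in_extension.simps)
next
  case (A5 Q D A g)
  have "Trusts Q (TPair (BPair D A (Lab bound))) \<in> M" if "Trusts Q (TPair (BPair D A g)) \<in> M"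
    using that M_bound R_in_M other_principal_in_M by (cases "Q = P") blast+
  with A5 show ?thesis by (simp del: in_extension.simps)
next
  case (A6 Q D A \<pi>)
  have "Trusts P (TSays (Says D A (BPair D A (Lab bound)))) \<in> R"
    if R: "Trusts P (TSays (Says D A \<pi>)) \<in> R"
  proof (cases \<pi>)
    case (BPair D2 A2 g)
    with R_says[of D A D2 A2 g] R show ?thesis
      by (intro ax_closed[OF ax.A6[of P D A \<pi>]]) (auto intro!: antecedent.intros trusts_in_All)
  qed
  with A6 show ?thesis by auto
next
  case (A7 Q D A l)
  have "Trusts P (TPair (BPair D A (Satt l))) \<in> M" if M: "Trusts P (TPair (BPair D A (SattStar l))) \<in> M"
  proof (rule satt_in_M)
    assume "Satt l \<in> L"
    then have R: "Trusts P (TPair (BPair D A (SattStar l))) \<in> R"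
      using M_limited[OF M] L_upward[of "Satt l" "SattStar l"] by simp
    show "Trusts P (TPair (BPair D A (Satt l))) \<in> R"
      using R_pair[OF R] R \<open>Satt l \<in> L\<close>
      by (intro ax_closed[OF ax.A7[of P D A l]]) (auto intro!: antecedent.intros trusts_in_All)
  qed (use M_bound[OF M] in auto)
  then have "Trusts Q (TPair (BPair D A (Satt l))) \<in> M" if "Trusts Q (TPair (BPair D A (SattStar l))) \<in> M"
    using that other_principal_in_M by (cases "Q = P") blast+
  with A7 show ?thesis by (simp del: in_extension.simps)
next
  case (A8 Q D1 A1 D2 A2 l)
  have "Trusts P (TSays (Says D1 A1 (BPair D2 A2 (Satt l)))) \<in> R"
    if R: "Trusts P (TSays (Says D1 A1 (BPair D2 A2 (SattStar l)))) \<in> R"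
    using R_says[of D1 A1 D2 A2 "SattStar l"] R L_upward[of "SattStar l" "Satt l"]
    by (intro ax_closed[OF ax.A8[of P D1 A1 D2 A2 l]]) (auto intro!: antecedent.intros trusts_in_All)
  with A8 show ?thesis by auto
next
  case (A9 l2 l1 Q D A)
  have "Trusts P (TPair (BPair D A (Satt l2))) \<in> M"
    if le: "l2 \<le> l1" and M: "Trusts P (TPair (BPair D A (Satt l1))) \<in> M"
  proof (rule satt_in_M)
    assume "Satt l2 \<in> L"
    \<comment> \<open>Upward closure leads from the narrower label of the conclusion to the broader
      one of the premise, so the premise is not true merely by default.\<close>
    then have R: "Trusts P (TPair (BPair D A (Satt l1))) \<in> R"
      using M_limited[OF M] L_upward[of "Satt l2" "Satt l1"] le by simp
    show "Trusts P (TPair (BPair D A (Satt l2))) \<in> R"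
      using R_pair[OF R] R \<open>Satt l2 \<in> L\<close> le
      by (intro ax_closed[OF ax.A9[of l2 l1]]) (auto intro!: antecedent.intros trusts_in_All)
  qed (use M_bound[OF M] in auto)
  then have "Trusts Q (TPair (BPair D A (Satt l2))) \<in> M"
    if "l2 \<le> l1" "Trusts Q (TPair (BPair D A (Satt l1))) \<in> M"
    using that other_principal_in_M by (cases "Q = P") blast+
  with A9 show ?thesis by (simp del: in_extension.simps)
next
  case (A10 l2 l1 Q D A)
  have "Trusts P (TPair (BPair D A (SattStar l2))) \<in> M"
    if le: "l2 \<le> l1" and M: "Trusts P (TPair (BPair D A (SattStar l1))) \<in> M"
  proof (rule satt_in_M)
    assume "SattStar l2 \<in> L"
    then have R: "Trusts P (TPair (BPair D A (SattStar l1))) \<in> R"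
      using M_limited[OF M] L_upward[of "SattStar l2" "SattStar l1"] le by simp
    show "Trusts P (TPair (BPair D A (SattStar l2))) \<in> R"
      using R_pair[OF R] R \<open>SattStar l2 \<in> L\<close> le
      by (intro ax_closed[OF ax.A10[of l2 l1]]) (auto intro!: antecedent.intros trusts_in_All)
  qed (use M_bound[OF M] in auto)
  then have "Trusts Q (TPair (BPair D A (SattStar l2))) \<in> M"
    if "l2 \<le> l1" "Trusts Q (TPair (BPair D A (SattStar l1))) \<in> M"
    using that other_principal_in_M by (cases "Q = P") blast+
  with A10 show ?thesis by (simp del: in_extension.simps)
next
  case (A11 D A \<pi> Q)
  have "Trusts P (TSays (Says D A \<pi>)) \<in> R" if R: "SaysSt (Says D A \<pi>) \<in> R"
  proof (cases \<pi>)
    case (BPair D2 A2 g)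
    with R_says[of D A D2 A2 g] R show ?thesis
      by (intro ax_closed[OF ax.A11[of D A \<pi>]]) (auto intro!: antecedent.intros trusts_in_All)
  qed
  with A11 show ?thesis by auto
qed simp_all

section \<open>Truth of the local axioms, and completeness of saturated sets\<close>

lemma schema_instance_in_R:
  assumes "las_ax P LAS (St (Trusts P (TPair (BPair D A g))))"
    and "(D, A) \<in> I" "Lab bound \<in> L" "g \<in> L"
  shows "Trusts P (TPair (BPair D A g)) \<in> R"
  using assms by (intro closed) (simp_all add: mem_maxlim one_step_def trusts_in_All)

text \<open>Treats \<open>Satt\<close> and \<open>SattStar\<close> at once, as values of
  \<open>f\<close>. The instance at label \<open>bound\<close> lies in the saturation space, and
  \<open>A5\<close> turns it into the bound pair that the default clause asks for.\<close>

lemma schema_instance_in_M: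
  assumes ax: "\<And>l. las_ax P LAS (St (Trusts P (TPair (BPair D A (f l)))))"
    and D: "(D, A) \<in> las_IDs LAS" and f: "\<And>l. f l \<notin> range Lab" "\<And>l. blabel (f l) = l"
  shows "Trusts P (TPair (BPair D A (f l))) \<in> M"
proof -
  \<comment> \<open>Any statement of \<open>T\<close> contributes \<open>bound\<close> to its
    labels.\<close>
  have "T \<noteq> {}" using D nonempty by auto
  then have bound: "Lab bound \<in> L"
    using lc_increasing[of "labels T \<union> las_labels LAS"] unfolding lcP_def labels_def by blast
  then have "f bound \<in> L" using L_upward[of "Lab bound" "f bound"] f(2) by simp
  with bound D have "Trusts P (TPair (BPair D A (f bound))) \<in> R"
    by (intro schema_instance_in_R[OF ax]) auto
  from R_bound[OF this] show ?thesis
    using bound D f by (intro satt_in_M schema_instance_in_R[OF ax]) auto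
qed

lemma las_ax_true:
  assumes "las_ax P LAS \<phi>"
  shows "form_true M \<phi>"
  using assms
proof cases
  case (1 g1 g2 D A)
  \<comment> \<open>\<open>L\<close> contains the schema parameters, so a premise true in
    \<open>M\<close> is in \<open>R\<close> and the conclusion stays within the space.\<close>
  have L: "g1 \<in> L" "g2 \<in> L"
    using 1(2) lc_increasing[of "labels T \<union> las_labels LAS"]
    unfolding lcP_def las_labels_def by force+
  have "Trusts P (TPair (BPair D A g2)) \<in> R" if "Trusts P (TPair (BPair D A g1)) \<in> M"
  proof -
    have R: "Trusts P (TPair (BPair D A g1)) \<in> R"
      using M_limited[OF that] L by simp
    then have "one_step P LAS R (Trusts P (TPair (BPair D A g2)))"
      using las_ax.intros(1)[OF 1(2)] unfolding one_step_def by (blast intro: antecedent.intros)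
    then show ?thesis
      using R_pair[OF R] L by (intro closed) (auto simp: mem_maxlim intro: trusts_in_All)
  qed
  then show ?thesis
    using 1(1) R_in_M by (auto simp del: in_extension.simps)
next
  case (2 D A l)
  have "(D, A) \<in> las_IDs LAS" using 2(2) unfolding las_IDs_def by force
  with 2 schema_instance_in_M[of D A Satt l] show ?thesis
    by (auto intro: las_ax.intros simp del: in_extension.simps)
next
  case (3 D A l)
  have "(D, A) \<in> las_IDs LAS" using 3(2) unfolding las_IDs_def by force
  with 3 schema_instance_in_M[of D A SattStar l] show ?thesis
    by (auto intro: las_ax.intros simp del: in_extension.simps)
qed

text \<open>On sattestor-free statements of \<open>All_stmts P\<close> the extension agrees with
  \<open>R\<close>, so truth in \<open>M\<close> is membership in \<open>R\<close>.\<close>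

lemma derivable_in_R:
  assumes "derivable P LAS T (St s)" "s \<in> All_stmts P" "satt_free s"
  shows "s \<in> R"
proof -
  have "form_true M (St s)"
    by (rule derivable_true[OF assms(1) order_trans[OF T_subset R_in_M] ax_true las_ax_true])
  with assms(2,3) show ?thesis
  proof (cases s rule: stmt_cases)
    case (trusts_pair Q D A g)
    with \<open>form_true M (St s)\<close> assms(2,3) show ?thesis
      by (cases g) (auto simp: satt_free_def All_stmts_def)
  qed (auto simp: All_stmts_def)
qed

end

section \<open>Loop invariant and termination\<close>

text \<open>The final disjunction says that everything in \<open>S\<close> obtainable from
  \<open>Past\<close> in one step has been added, except at the start, before any round. At exit
  \<open>Past = Present\<close> turns this into closedness.\<close>

definition saturation_inv where
  "saturation_inv P LAS T S = (\<lambda>(Present, Past, Rest).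
     T \<subseteq> Present \<and> Past \<subseteq> Present \<and> Present \<subseteq> S \<and> Rest = S - Present
     \<and> (\<forall>s\<in>Present. derivable P LAS T (St s))
     \<and> (Past = {} \<and> Present = T \<or> {s \<in> S. one_step P LAS Past s} \<subseteq> Present))"

text \<open>Scanning only \<open>Rest\<close> loses nothing, since \<open>Rest\<close> is the
  complement of \<open>Present\<close> in \<open>S\<close>.\<close>

lemma saturation_inv_round:
  assumes "saturation_inv P LAS T S x"
  shows "saturation_inv P LAS T S (saturation_round P LAS S x)"
  using assms one_step_derivable[of P LAS "fst x" _ T]
  unfolding saturation_inv_def saturation_round_def Let_def by (cases x) auto

lemma saturate_terminates:
  assumes S: "finite S" and T: "T \<subseteq> S"
  obtains R where
    "while_option (\<lambda>(Present, Past, Rest). Present \<noteq> Past) (saturation_round P LAS S) (T, {}, S - T)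
       = Some (R, R, S - R)"
    and "saturation_inv P LAS T S (R, R, S - R)"
proof -
  let ?b = "\<lambda>(Present, Past, Rest). Present \<noteq> Past"
  let ?c = "saturation_round P LAS S"
  have start: "saturation_inv P LAS T S (T, {}, S - T)"
    using T unfolding saturation_inv_def by (auto intro: derivable.premise)
  \<comment> \<open>The measure follows \<open>Past\<close>, since the last round leaves
    \<open>Present\<close> unchanged, whereas \<open>Past\<close> always moves up to the strictly
    larger \<open>Present\<close>.\<close>
  have decrease: "card (S - fst (snd (?c x))) < card (S - fst (snd x))"
    if "saturation_inv P LAS T S x" "?b x" for x
  proof (intro psubset_card_mono finite_Diff S)
    show "S - fst (snd (?c x)) \<subset> S - fst (snd x)"
      using that unfolding saturation_inv_def saturation_round_def Let_def by (cases x) auto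
  qed
  have "\<exists>t. while_option ?b ?c (T, {}, S - T) = Some t"
  proof (rule measure_while_option_Some)
    fix x assume "saturation_inv P LAS T S x" "?b x"
    then show "saturation_inv P LAS T S (?c x) \<and> card (S - fst (snd (?c x))) < card (S - fst (snd x))"
      using saturation_inv_round decrease by blast
  qed (rule start)
  then obtain t where t: "while_option ?b ?c (T, {}, S - T) = Some t" ..
  then have "saturation_inv P LAS T S t"
    by (rule while_option_rule[rotated]) (use start saturation_inv_round in blast)+
  moreover from this while_option_stop[OF t] obtain R where "t = (R, R, S - R)"
    unfolding saturation_inv_def by (cases t) auto
  ultimately show ?thesis using that t by blast
qed

section \<open>Correctness of the saturation algorithm\<close>

text \<open>Completeness is guarded because for empty \<open>T\<close> the loop stops before its
  first round, while a \<open>SATT\<close> schema and \<open>A5\<close> still yield a sattestor-free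
  trust statement. The bounds in terms of \<open>T\<close> alone are guarded because schemata may
  bring in labels and identities foreign to \<open>T\<close>.\<close>

theorem mainTheorem7:
  fixes P :: "('p, 'd, 'o) principal"
    and LAS :: "('d, 'o, 'l::sat_label) schema set"
    and T :: "('p, 'd, 'o, 'l) stmt set"
  assumes "finite LAS"
    and "finite T"
    and "T \<subseteq> All_stmts P"
  shows "\<exists>Resulta Resultb. saturate P LAS T = Some (Resulta, Resultb)
    \<and> (\<forall>s\<in>Resultb. derivable P LAS T (St s))
    \<and> ((T = {} \<longrightarrow> las_IDs LAS = {}) \<longrightarrow>
        (\<forall>s\<in>All_stmts P. satt_free s \<and> derivable P LAS T (St s) \<longrightarrow> s \<in> Resultb))
    \<and> labels Resultb \<subseteq> lcP T LAS
    \<and> IDs Resultb \<subseteq> IDs T \<union> las_IDs LAS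
    \<and> (las_labels LAS \<subseteq> lc (labels T) \<longrightarrow> labels Resultb \<subseteq> lc (labels T))
    \<and> (las_IDs LAS \<subseteq> IDs T \<longrightarrow> IDs Resultb \<subseteq> IDs T)"
proof -
  let ?S = "maxlim LAS (All_stmts P) T"
  have T: "T \<subseteq> ?S"
    using assms(3) by (rule maxlim_extends)
  obtain R where
    R: "while_option (\<lambda>(Present, Past, Rest). Present \<noteq> Past) (saturation_round P LAS ?S)
          (T, {}, ?S - T) = Some (R, R, ?S - R)"
    and inv: "saturation_inv P LAS T ?S (R, R, ?S - R)"
    using saturate_terminates[OF finite_limited_stmts[OF assms(2,1)] T] .
  have "saturate P LAS T = Some (R, sattfree R)"
    unfolding saturate_def Let_def R by simp
  moreover have "\<forall>s\<in>sattfree R. derivable P LAS T (St s)"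
    using inv unfolding saturation_inv_def sattfree_def by simp
  moreover have "s \<in> sattfree R"
    if "T = {} \<longrightarrow> las_IDs LAS = {}" "s \<in> All_stmts P" "satt_free s" "derivable P LAS T (St s)" for s
  proof -
    \<comment> \<open>For empty \<open>T\<close> no round is run, so the invariant does not give
      closedness. The saturation space is then empty, as every statement mentions an
      identity.\<close>
    have "?S = {}" if "T = {}"
      using that \<open>T = {} \<longrightarrow> las_IDs LAS = {}\<close>
      by (auto simp: mem_maxlim IDs_def stmt_IDs_nonempty)
    then interpret saturated P LAS T R
      using inv that(1) unfolding saturation_inv_def by unfold_locales auto
    show ?thesis
      using derivable_in_R that unfolding sattfree_def by simp
  qed
  moreover have "labels (sattfree R) \<subseteq> lcP T LAS" "IDs (sattfree R) \<subseteq> IDs T \<union> las_IDs LAS"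
  proof -
    have "sattfree R \<subseteq> ?S"
      using inv unfolding saturation_inv_def sattfree_def by auto
    then show "labels (sattfree R) \<subseteq> lcP T LAS" "IDs (sattfree R) \<subseteq> IDs T \<union> las_IDs LAS"
      using maxlim_greatest(2)[of LAS T "All_stmts P"]
      unfolding limited_def labels_def IDs_def by blast+
  qed
  \<comment> \<open>\<open>lc (labels T)\<close> is already closed upwards, so schema labels inside
    it do not enlarge the closure.\<close>
  moreover have "lcP T LAS \<subseteq> lc (labels T)" if "las_labels LAS \<subseteq> lc (labels T)"
    unfolding lcP_def using that lc_increasing by (intro lc_least) auto
  ultimately show ?thesis
    by (intro exI[of _ R] exI[of _ "sattfree R"] conjI) (simp_all, blast+)
qed

end
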